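(* Let $S$ be a non-symmetric numerical semigroup with $\mathrm{m}(S)<\mathrm{F}(S)$. Then the following conditions are equivalent: (1) $S$ is an almost symmetric numerical semigroup with maximal reduced type; (2) there exist integers $t,m$ such that $2\le t<m$ and $S=\Delta(m)\setminus\{2m-t\}$.
   Context: $\mathbb{N}=\{z\in\mathbb{Z}\mid z\ge 0\}$. A numerical semigroup is a submonoid $S$ of $(\mathbb{N},+)$ (containing $0$) with $\mathbb{N}\setminus S$ finite. The multiplicity $\mathrm{m}(S)$ is the smallest element of $S\setminus\{0\}$; the Frobenius number $\mathrm{F}(S)$ is the largest element of $\mathbb{Z}\setminus S$; the genus $\mathrm{g}(S)$ is the cardinality of $\mathbb{N}\setminus S$. The set of pseudo-Frobenius numbers is $\mathrm{PF}(S)=\{x\in\mathbb{Z}\setminus S\mid x+s\in S\text{ for all }0\ne s\in S\}$, and the type $\mathrm{t}(S)$ is its cardinality. $S$ is symmetric if $\mathrm{t}(S)=1$. $S$ is almost symmetric if $\mathrm{g}(S)=\frac{\mathrm{F}(S)+\mathrm{t}(S)}{2}$. Put $\mathrm{rPF}(S)=\{x\in\mathbb{Z}\setminus S\mid \mathrm{F}(S)-\mathrm{m}(S)+1\le x\le \mathrm{F}(S)\}$ and let $s(S)$ be its cardinality (the reduced type); $S$ has maximal reduced type if $s(S)=\mathrm{t}(S)$. For a positive integer $m$, $\Delta(m)=\{x\in\mathbb{N}\mid x\ge m\}\cup\{0\}$. *)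

theory Defs
  imports Complex_Main
begin

text \<open>
  Numerical semigroups are sets of integers, the set of natural numbers being \<open>{0::int..}\<close>:
  several of the invariants below refer to the complement in the integers, which always
  contains the negative integers.
\<close>

definition numerical_semigroup :: "int set \<Rightarrow> bool" where
  "numerical_semigroup S \<longleftrightarrow>
     S \<subseteq> {0..} \<and> 0 \<in> S \<and> (\<forall>x\<in>S. \<forall>y\<in>S. x + y \<in> S) \<and> finite ({0..} - S)"

definition ns_multiplicity :: "int set \<Rightarrow> int" where
  "ns_multiplicity S = (LEAST x. x \<in> S - {0})"

definition frobenius_number :: "int set \<Rightarrow> int" where
  "frobenius_number S = (GREATEST x. x \<in> - S)"

definition genus :: "int set \<Rightarrow> nat" where
  "genus S = card ({0..} - S)"

definition PF :: "int set \<Rightarrow> int set" where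
  "PF S = {x \<in> - S. \<forall>s\<in>S. s \<noteq> 0 \<longrightarrow> x + s \<in> S}"

definition ns_type :: "int set \<Rightarrow> nat" where
  "ns_type S = card (PF S)"

definition ns_symmetric :: "int set \<Rightarrow> bool" where
  "ns_symmetric S \<longleftrightarrow> ns_type S = 1"

definition almost_symmetric :: "int set \<Rightarrow> bool" where
  "almost_symmetric S \<longleftrightarrow>
     real (genus S) = (real_of_int (frobenius_number S) + real (ns_type S)) / 2"

definition rPF :: "int set \<Rightarrow> int set" where
  "rPF S = {x \<in> - S. frobenius_number S - ns_multiplicity S + 1 \<le> x \<and> x \<le> frobenius_number S}"

definition reduced_type :: "int set \<Rightarrow> nat" where
  "reduced_type S = card (rPF S)"

definition maximal_reduced_type :: "int set \<Rightarrow> bool" where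
  "maximal_reduced_type S \<longleftrightarrow> reduced_type S = ns_type S"

definition Delta :: "int \<Rightarrow> int set" where
  "Delta m = {x \<in> {0..}. x \<ge> m} \<union> {0}"

end

theory Submission
  imports Defs
begin

text \<open>
  Write \<open>F\<close> for the Frobenius number and \<open>m\<close> for the multiplicity, and let \<open>L\<close> be the set of
  gaps \<open>x\<close> whose mirror image \<open>F - x\<close> is again a gap. Almost symmetry and maximality of the
  reduced type correspond to equality in one inclusion each of the chain

    \<open>rPF S - {F} \<subseteq> PF S - {F} \<subseteq> L\<close>.

  The left inclusion holds because adding a nonzero element of \<open>S\<close> to an
  element of \<open>rPF S\<close> leads beyond \<open>F\<close>, and it is an equality iff the reduced type is
  maximal, since all sets are finite. The right one holds because \<open>x + (F - x) = F\<close> is a gap.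
  Reflection in \<open>F\<close> embeds \<open>S \<inter> {0..F}\<close> into the gaps with complement \<open>L\<close>, so \<open>L\<close> has
  \<open>2 g - F - 1\<close> elements, and the right inclusion is an equality iff \<open>S\<close> is almost symmetric.
  Hence both together amount to \<open>L \<subseteq> rPF S\<close>.

  If \<open>L \<subseteq> rPF S\<close>, every element of \<open>L\<close> is at least \<open>F - m + 1\<close>; as \<open>L\<close> is invariant under
  \<open>x \<mapsto> F - x\<close>, every element is also at most \<open>m - 1\<close>. A non-symmetric \<open>S\<close> has nonempty \<open>L\<close>,
  so \<open>F - m + 1 \<le> m - 1\<close>. A gap strictly between \<open>m\<close> and \<open>F\<close> would then belong to
  \<open>rPF S - {F} \<subseteq> L\<close> and yet exceed \<open>m - 1\<close>. So \<open>F\<close> is the only gap above \<open>m\<close>, and \<open>S\<close> is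
  \<open>Delta m - {2 * m - t}\<close> with \<open>t = 2 m - F\<close>. Conversely, the gaps of such a semigroup other
  than \<open>F\<close> are less than \<open>m\<close>; applied to the mirror image of an element of \<open>L\<close>, this is
  exactly the lower bound that membership in \<open>rPF S\<close> demands.
\<close>

section \<open>Frobenius number and multiplicity\<close>

lemma frobenius_number_eqI:
  assumes "F \<notin> S" and "\<And>x. F < x \<Longrightarrow> x \<in> S"
  shows "frobenius_number S = F"
  unfolding frobenius_number_def
  using assms by (intro Greatest_equality) (auto intro: leI)

lemma ns_multiplicity_eqI:
  assumes "m \<in> S" "m \<noteq> 0" and "\<And>x. x \<in> S \<Longrightarrow> x \<noteq> 0 \<Longrightarrow> m \<le> x"
  shows "ns_multiplicity S = m"
  unfolding ns_multiplicity_def using assms by (intro Least_equality) auto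

lemma
  assumes "numerical_semigroup S"
  shows frobenius_number_notin: "frobenius_number S \<notin> S"
    and in_semigroup_if_greater_frobenius: "frobenius_number S < x \<Longrightarrow> x \<in> S"
proof -
  (* Adjoining -1 covers the semigroup of all natural numbers, whose Frobenius number is -1. *)
  define G where "G = insert (-1) ({0..} - S)"
  have G: "finite G" "G \<noteq> {}" "G \<subseteq> - S"
    using assms by (auto simp: G_def numerical_semigroup_def)
  have "Max G \<notin> S" using Max_in[OF G(1,2)] G(3) by blast
  moreover have above: "x \<in> S" if "Max G < x" for x
  proof (rule ccontr)
    assume "x \<notin> S"
    moreover have "-1 \<le> Max G" using G(1) by (simp add: G_def)
    ultimately have "x \<in> G" using that by (simp add: G_def)
    then show False using Max_ge[OF G(1)] that by fastforce
  qed
  ultimately have "frobenius_number S = Max G" by (rule frobenius_number_eqI)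
  then show "frobenius_number S \<notin> S" "frobenius_number S < x \<Longrightarrow> x \<in> S"
    using \<open>Max G \<notin> S\<close> above by simp_all
qed

lemma notin_semigroup_le_frobenius:
  "numerical_semigroup S \<Longrightarrow> x \<notin> S \<Longrightarrow> x \<le> frobenius_number S"
  using in_semigroup_if_greater_frobenius[of S x] by force

lemma
  assumes "numerical_semigroup S"
  shows ns_multiplicity_in: "ns_multiplicity S \<in> S"
    and ns_multiplicity_pos: "0 < ns_multiplicity S"
    and ns_multiplicity_le: "x \<in> S \<Longrightarrow> x \<noteq> 0 \<Longrightarrow> ns_multiplicity S \<le> x"
proof -
  define a where "a = max 1 (frobenius_number S + 1)"
  define A where "A = S \<inter> {1..a}"
  have "a \<in> S" using in_semigroup_if_greater_frobenius[OF assms, of a] by (simp add: a_def)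
  then have A: "finite A" "A \<noteq> {}" by (auto simp: A_def a_def)
  have MA: "Min A \<in> S" "0 < Min A" "Min A \<le> a"
    using Min_in[OF A] by (auto simp: A_def)
  have least: "Min A \<le> x" if "x \<in> S" "x \<noteq> 0" for x
  proof (cases "x \<le> a")
    case True
    have "0 \<le> x" using that assms by (auto simp: numerical_semigroup_def)
    with True that have "x \<in> A" by (simp add: A_def)
    then show ?thesis by (rule Min_le[OF A(1)])
  qed (use MA in simp)
  have "ns_multiplicity S = Min A" using MA least by (intro ns_multiplicity_eqI) auto
  then show "ns_multiplicity S \<in> S" "0 < ns_multiplicity S"
    "x \<in> S \<Longrightarrow> x \<noteq> 0 \<Longrightarrow> ns_multiplicity S \<le> x"
    using MA least by auto
qed

section \<open>Gaps whose mirror image is a gap\<close>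

definition mirror_gaps :: "int set \<Rightarrow> int set" where
  "mirror_gaps S = {x \<in> {0..} - S. frobenius_number S - x \<in> {0..} - S}"

lemma mirror_gaps_reflect:
  "x \<in> mirror_gaps S \<Longrightarrow> frobenius_number S - x \<in> mirror_gaps S"
  by (simp add: mirror_gaps_def)

lemma finite_mirror_gaps:
  "numerical_semigroup S \<Longrightarrow> finite (mirror_gaps S)"
  by (rule finite_subset[of _ "{0..} - S"]) (auto simp: mirror_gaps_def numerical_semigroup_def)

lemma frobenius_notin_mirror_gaps:
  "numerical_semigroup S \<Longrightarrow> frobenius_number S \<notin> mirror_gaps S"
  by (auto simp: mirror_gaps_def numerical_semigroup_def)

text \<open>
  The gaps in \<open>{0..F}\<close> are the reflections of the elements of \<open>S\<close> in that interval together
  with the mirror gaps; the elements of \<open>S\<close> there number \<open>F + 1 - g\<close>.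
\<close>

lemma card_mirror_gaps:
  assumes "numerical_semigroup S" and "0 < frobenius_number S"
  shows "int (card (mirror_gaps S)) = 2 * int (genus S) - frobenius_number S - 1"
proof -
  define F where "F = frobenius_number S"
  define G where "G = {0..} - S"
  define N where "N = S \<inter> {0..F}"
  have fin: "finite G" "finite N"
    using assms(1) by (auto simp: G_def N_def numerical_semigroup_def)
  have GF: "G \<subseteq> {0..F}"
    using notin_semigroup_le_frobenius[OF assms(1)] by (auto simp: G_def F_def)
  have "G \<union> N = {0..F}" "G \<inter> N = {}" using GF by (auto simp: G_def N_def)
  then have interval: "int (card G) + int (card N) = F + 1"
    using card_Un_disjoint[OF fin] assms(2) by (simp add: F_def)
  have "F - s \<notin> S" if "s \<in> S" for s
  proof
    assume "F - s \<in> S"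
    with that assms(1) have "s + (F - s) \<in> S" unfolding numerical_semigroup_def by blast
    then show False using frobenius_number_notin[OF assms(1)] by (simp add: F_def)
  qed
  then have sub: "(\<lambda>s. F - s) ` N \<subseteq> G" by (auto simp: N_def G_def)
  have "mirror_gaps S = G - (\<lambda>s. F - s) ` N"
  proof (intro set_eqI iffI)
    fix x assume "x \<in> mirror_gaps S"
    then show "x \<in> G - (\<lambda>s. F - s) ` N"
      by (auto simp: mirror_gaps_def G_def N_def F_def)
  next
    fix x assume x: "x \<in> G - (\<lambda>s. F - s) ` N"
    then have "x \<in> {0..F}" using GF by blast
    then have "F - x \<notin> S" using x by (force simp: N_def)
    then show "x \<in> mirror_gaps S"
      using x \<open>x \<in> {0..F}\<close> by (simp add: mirror_gaps_def G_def F_def)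
  qed
  moreover have "card ((\<lambda>s. F - s) ` N) = card N" by (intro card_image inj_onI) simp
  ultimately have "card (mirror_gaps S) = card G - card N" "card N \<le> card G"
    using card_Diff_subset[OF _ sub] card_mono[OF fin(1) sub] fin by auto
  then show ?thesis using interval by (simp add: genus_def G_def F_def)
qed

section \<open>The chain of inclusions\<close>

lemma frobenius_in_rPF:
  assumes "numerical_semigroup S"
  shows "frobenius_number S \<in> rPF S"
  using frobenius_number_notin[OF assms] ns_multiplicity_pos[OF assms] by (simp add: rPF_def)

lemma rPF_subset_PF:
  assumes "numerical_semigroup S"
  shows "rPF S \<subseteq> PF S"
proof
  fix x assume x: "x \<in> rPF S"
  have "x + s \<in> S" if "s \<in> S" "s \<noteq> 0" for s
    using ns_multiplicity_le[OF assms that] x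
    by (intro in_semigroup_if_greater_frobenius[OF assms]) (simp add: rPF_def)
  then show "x \<in> PF S" using x by (simp add: PF_def rPF_def)
qed

text \<open>
  A negative number cannot be pseudo-Frobenius when \<open>F > 0\<close>: its reflection lies beyond \<open>F\<close>,
  hence is a nonzero element of \<open>S\<close>, and the two add up to the gap \<open>F\<close>.
\<close>

lemma PF_subset_mirror_gaps:
  assumes "numerical_semigroup S" and "0 < frobenius_number S"
  shows "PF S - {frobenius_number S} \<subseteq> mirror_gaps S"
proof
  fix x assume x: "x \<in> PF S - {frobenius_number S}"
  have refl: "frobenius_number S - x \<notin> S"
  proof
    assume "frobenius_number S - x \<in> S"
    with x have "x + (frobenius_number S - x) \<in> S"
      unfolding PF_def by fastforce
    then show False using frobenius_number_notin[OF assms(1)] by simp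
  qed
  have "x \<le> frobenius_number S"
    using x notin_semigroup_le_frobenius[OF assms(1)] by (simp add: PF_def)
  moreover have "0 \<le> x"
    using notin_semigroup_le_frobenius[OF assms(1) refl] by simp
  ultimately show "x \<in> mirror_gaps S" using refl x by (simp add: mirror_gaps_def PF_def)
qed

lemma finite_PF:
  assumes "numerical_semigroup S" and "0 < frobenius_number S"
  shows "finite (PF S)"
  using finite_subset[OF PF_subset_mirror_gaps[OF assms] finite_mirror_gaps[OF assms(1)]] by simp

lemma maximal_reduced_type_iff:
  assumes "numerical_semigroup S" and "0 < frobenius_number S"
  shows "maximal_reduced_type S \<longleftrightarrow> rPF S = PF S"
  unfolding maximal_reduced_type_def reduced_type_def ns_type_def
  using card_subset_eq[OF finite_PF[OF assms] rPF_subset_PF[OF assms(1)]] by metis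

lemma almost_symmetric_iff:
  assumes "numerical_semigroup S" and "0 < frobenius_number S"
  shows "almost_symmetric S \<longleftrightarrow> PF S - {frobenius_number S} = mirror_gaps S"
proof -
  let ?F = "frobenius_number S"
  have "?F \<in> PF S" using frobenius_in_rPF rPF_subset_PF assms(1) by blast
  then have type: "ns_type S = Suc (card (PF S - {?F}))"
    unfolding ns_type_def using finite_PF[OF assms] by (metis card.remove)
  have "almost_symmetric S \<longleftrightarrow> real_of_int (2 * int (genus S)) = real_of_int (?F + int (ns_type S))"
    by (simp add: almost_symmetric_def field_simps)
  also have "\<dots> \<longleftrightarrow> card (PF S - {?F}) = card (mirror_gaps S)"
    unfolding of_int_eq_iff using card_mirror_gaps[OF assms] type by linarith
  also have "\<dots> \<longleftrightarrow> PF S - {?F} = mirror_gaps S"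
    using card_subset_eq[OF finite_mirror_gaps[OF assms(1)] PF_subset_mirror_gaps[OF assms]] by metis
  finally show ?thesis .
qed

text \<open>
  Since \<open>rPF S - {F} \<subseteq> PF S - {F} \<subseteq> L\<close>, both inclusions are equalities iff the outer sets
  agree; this eliminates \<open>PF S\<close>.
\<close>

lemma almost_symmetric_maximal_reduced_type_iff:
  assumes "numerical_semigroup S" and "0 < frobenius_number S"
  shows "almost_symmetric S \<and> maximal_reduced_type S \<longleftrightarrow> mirror_gaps S \<subseteq> rPF S"
  unfolding almost_symmetric_iff[OF assms] maximal_reduced_type_iff[OF assms]
  using rPF_subset_PF[OF assms(1)] PF_subset_mirror_gaps[OF assms] frobenius_in_rPF[OF assms(1)]
    frobenius_notin_mirror_gaps[OF assms(1)]
  by blast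

lemma mirror_gaps_nonempty:
  assumes "numerical_semigroup S" and "0 < frobenius_number S" and "\<not> ns_symmetric S"
  shows "mirror_gaps S \<noteq> {}"
proof
  assume "mirror_gaps S = {}"
  then have "PF S = {frobenius_number S}"
    using PF_subset_mirror_gaps[OF assms(1,2)] frobenius_in_rPF[OF assms(1)]
      rPF_subset_PF[OF assms(1)] by blast
  then show False using assms(3) by (simp add: ns_symmetric_def ns_type_def)
qed

section \<open>The semigroups with a single gap above the multiplicity\<close>

lemma Delta_minus_invariants:
  assumes "2 \<le> t" and "t < m"
  shows "frobenius_number (Delta m - {2 * m - t}) = 2 * m - t"
    and "ns_multiplicity (Delta m - {2 * m - t}) = m"
  using assms
  by (auto intro!: frobenius_number_eqI ns_multiplicity_eqI simp: Delta_def)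

lemma mirror_gaps_Delta_minus:
  assumes "2 \<le> t" and "t < m"
  shows "mirror_gaps (Delta m - {2 * m - t}) \<subseteq> rPF (Delta m - {2 * m - t})"
  unfolding mirror_gaps_def rPF_def Delta_minus_invariants[OF assms]
  using assms by (auto simp: Delta_def)

text \<open>
  The lower bound on \<open>L\<close> given by \<open>rPF S\<close> reflects to an upper bound, which confines \<open>L\<close> to
  \<open>{F - m + 1..m - 1}\<close>; as \<open>L\<close> is nonempty, this forces \<open>F \<le> 2 m - 2\<close>. The window
  \<open>{F - m + 1..F}\<close> of \<open>rPF S\<close> then reaches below \<open>m\<close>, so all gaps from \<open>m\<close> up are in it.
\<close>

lemma eq_Delta_minus_if_mirror_gaps_subset_rPF:
  assumes S: "numerical_semigroup S" and "ns_multiplicity S < frobenius_number S"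
    and "mirror_gaps S \<noteq> {}" and sub: "mirror_gaps S \<subseteq> rPF S"
  shows "frobenius_number S \<le> 2 * ns_multiplicity S - 2"
    and "S = Delta (ns_multiplicity S) - {frobenius_number S}"
proof -
  let ?F = "frobenius_number S" and ?m = "ns_multiplicity S"
  have F: "0 < ?F" using assms(2) ns_multiplicity_pos[OF S] by simp
  have bounds: "?F - ?m + 1 \<le> x \<and> x \<le> ?m - 1" if "x \<in> mirror_gaps S" for x
    using sub that mirror_gaps_reflect[OF that] by (force simp: rPF_def)
  then show le: "?F \<le> 2 * ?m - 2" using assms(3) by fastforce
  have no_gap: "x \<in> S" if "?m \<le> x" "x \<noteq> ?F" for x
  proof (rule ccontr)
    assume gap: "x \<notin> S"
    then have "x \<le> ?F" by (rule notin_semigroup_le_frobenius[OF S])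
    then have "x \<in> rPF S" using gap that le by (simp add: rPF_def)
    then have "x \<in> mirror_gaps S"
      using that rPF_subset_PF[OF S] PF_subset_mirror_gaps[OF S F] by blast
    then show False using bounds that by force
  qed
  show "S = Delta ?m - {?F}"
  proof (intro set_eqI iffI)
    fix x assume "x \<in> S"
    then show "x \<in> Delta ?m - {?F}"
      using S ns_multiplicity_le[OF S, of x] frobenius_number_notin[OF S]
      by (auto simp: Delta_def numerical_semigroup_def)
  next
    fix x assume "x \<in> Delta ?m - {?F}"
    then show "x \<in> S" using no_gap S by (auto simp: Delta_def numerical_semigroup_def)
  qed
qed

theorem theorem1:
  fixes S :: "int set"
  assumes "numerical_semigroup S"
    and "\<not> ns_symmetric S"
    and "ns_multiplicity S < frobenius_number S"
  shows "(almost_symmetric S \<and> maximal_reduced_type S) \<longleftrightarrow>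
         (\<exists>t m :: int. 2 \<le> t \<and> t < m \<and> S = Delta m - {2 * m - t})"
proof -
  let ?F = "frobenius_number S" and ?m = "ns_multiplicity S"
  have F: "0 < ?F" using assms(3) ns_multiplicity_pos[OF assms(1)] by simp
  have "mirror_gaps S \<subseteq> rPF S \<longleftrightarrow>
      (\<exists>t m :: int. 2 \<le> t \<and> t < m \<and> S = Delta m - {2 * m - t})"
  proof
    assume "mirror_gaps S \<subseteq> rPF S"
    note eq_Delta_minus_if_mirror_gaps_subset_rPF[OF assms(1,3)
        mirror_gaps_nonempty[OF assms(1) F assms(2)] this]
    then have "2 \<le> 2 * ?m - ?F \<and> 2 * ?m - ?F < ?m \<and> S = Delta ?m - {2 * ?m - (2 * ?m - ?F)}"
      using assms(3) by simp
    then show "\<exists>t m :: int. 2 \<le> t \<and> t < m \<and> S = Delta m - {2 * m - t}" by blast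
  next
    assume "\<exists>t m :: int. 2 \<le> t \<and> t < m \<and> S = Delta m - {2 * m - t}"
    then show "mirror_gaps S \<subseteq> rPF S" using mirror_gaps_Delta_minus by blast
  qed
  then show ?thesis using almost_symmetric_maximal_reduced_type_iff[OF assms(1) F] by simp
qed

end
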